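(* Let $V$ be a finite set, $\mathbf k$ a field, $U_v$ a finite-dimensional $\mathbf k$-vector space for each $v\in V$, and $U=\bigoplus_{v\in V}U_v$. Let $\mathcal W$ be a finite collection of subspaces of $U$. For each $I\subseteq V$, let $m_I\in\mathbb Z_{\ge0}$ and let $\mathcal{F}\ell_I$ be a collection of complete flags of $U_I=\bigoplus_{v\in I}U_v$ in general position. Then there are flags $F^\bullet_{I,1},\dots,F^\bullet_{I,m_I}\in\mathcal F\ell_I$ for each $I\subseteq V$ such that for each $W\subseteq U$ in $\mathcal W$, each sequence $\mathcal J$ of subsets $J_1,\dots,J_d$ of $V$ such that $\nu^*_W+\xi_{\mathcal J}\ge0$, and each partition $\underline e_I=(e_{I,1},\dots,e_{I,m_I})$ of $\varepsilon_{\mathcal J}(I)$ into nonnegative integers for each $I\subseteq V$ (that is, $e_{I,r}\in\mathbb Z_{\ge0}$ and $\sum_re_{I,r}=\varepsilon_{\mathcal J}(I)$), we have $$\mathrm{UpMin}(\nu^*_W+\xi_{\mathcal J})=\nu^*_{W'}\qquad\text{for}\qquad W'=W\cap\bigcap_{I\subseteq V}\bigcap_{r=1}^{m_I}\theta_I^{-1}(F_{I,r}^{e_{I,r}})\subseteq U.$$ In particular, $\mathrm{codim}(W',W)=|\xi_{\mathcal J}(V)|=|\mathcal J|=d$.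
   Context: $\theta_I\colon U\to U_I$ is the natural projection. For a subspace $W\subseteq U$, $\nu^*_W\colon2^V\to\mathbb Z$ is $\nu^*_W(I)=\dim_{\mathbf k}\theta_I(W)$. For $J\subseteq V$, $\xi_J\colon2^V\to\mathbb Z$ is $\xi_J(I)=-1$ if $I\supseteq J$ and $0$ otherwise; $\xi_{\mathcal J}=\sum_{i=1}^d\xi_{J_i}$. $\varepsilon_{\mathcal J}(I)$ is the number of indices $i$ with $J_i=I$. For $\varphi\colon2^V\to\mathbb R$, $\varphi\ge0$ means that all values are nonnegative, and $\mathrm{UpMin}(\varphi)(I)=\min_{K\supseteq I}\varphi(K)$. A complete flag $F^\bullet$ of a vector space $U'$ of dimension $n$ is a decreasing filtration $0=F^n\subsetneq F^{n-1}\subsetneq\dots\subsetneq F^0=U'$ with $\mathrm{codim}(F^i,F^{i-1})=1$. A collection $\mathcal F\ell$ of complete flags of $U'$ is in general position if for each finite collection $\mathscr C$ of subspaces of $U'$ there is $F^\bullet\in\mathcal F\ell$ such that $\mathrm{codim}(Z\cap F^i,Z)=\min(\dim Z,i)$ for every $Z\in\mathscr C$ and every $0\le i\le\dim U'$. *)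

theory Defs
  imports Complex_Main "HOL-Library.Function_Algebras"
begin

(* The spaces U_v are subspaces of one ambient k-vector space 'b with scalar multiplication
   scale. Elements of the direct sum of the U_v, v in I, are the functions x :: 'v => 'b with
   x v in U_v for v in I and x v = 0 for all other v, so that U_I also lies in U. *)

definition fun_scale :: "('k \<Rightarrow> 'b \<Rightarrow> 'b) \<Rightarrow> 'k \<Rightarrow> ('v \<Rightarrow> 'b) \<Rightarrow> ('v \<Rightarrow> 'b)" where
  "fun_scale scale c x = (\<lambda>v. scale c (x v))"

lemma vector_space_fun_scale:
  fixes scale :: "'k::field \<Rightarrow> 'b::ab_group_add \<Rightarrow> 'b"
  assumes "vector_space scale"
  shows "vector_space (fun_scale scale :: 'k \<Rightarrow> ('v \<Rightarrow> 'b) \<Rightarrow> ('v \<Rightarrow> 'b))"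
proof -
  interpret vector_space scale by (fact assms)
  show ?thesis
    by unfold_locales
      (auto simp: fun_scale_def fun_eq_iff scale_right_distrib scale_left_distrib)
qed

definition direct_sum :: "('v \<Rightarrow> 'b::zero set) \<Rightarrow> 'v set \<Rightarrow> ('v \<Rightarrow> 'b) set" where
  "direct_sum Us I = {x. (\<forall>v\<in>I. x v \<in> Us v) \<and> (\<forall>v. v \<notin> I \<longrightarrow> x v = 0)}"

definition theta :: "'v set \<Rightarrow> ('v \<Rightarrow> 'b::zero) \<Rightarrow> ('v \<Rightarrow> 'b)" where
  "theta I x = (\<lambda>v. if v \<in> I then x v else 0)"

definition fin_dim_subspace :: "('k::field \<Rightarrow> 'b::ab_group_add \<Rightarrow> 'b) \<Rightarrow> 'b set \<Rightarrow> bool" where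
  "fin_dim_subspace scale S \<longleftrightarrow>
     module.subspace scale S \<and> (\<exists>B. finite B \<and> module.span scale B = S)"

(* Only used for finite-dimensional subspaces A of B, where it is the dimension of B / A. *)
definition codim :: "('k::field \<Rightarrow> 'b::ab_group_add \<Rightarrow> 'b) \<Rightarrow> 'b set \<Rightarrow> 'b set \<Rightarrow> int" where
  "codim scale A B = int (vector_space.dim scale B) - int (vector_space.dim scale A)"

(* The values F i for i > dim U' play no role. *)
definition complete_flag ::
  "('k::field \<Rightarrow> 'b::ab_group_add \<Rightarrow> 'b) \<Rightarrow> 'b set \<Rightarrow> (nat \<Rightarrow> 'b set) \<Rightarrow> bool" where
  "complete_flag scale U' F \<longleftrightarrow>
     F 0 = U' \<and> F (vector_space.dim scale U') = {0} \<and>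
     (\<forall>i\<le>vector_space.dim scale U'. module.subspace scale (F i)) \<and>
     (\<forall>i\<in>{1..vector_space.dim scale U'}. F i \<subset> F (i - 1) \<and> codim scale (F i) (F (i - 1)) = 1)"

definition general_position ::
  "('k::field \<Rightarrow> 'b::ab_group_add \<Rightarrow> 'b) \<Rightarrow> 'b set \<Rightarrow> (nat \<Rightarrow> 'b set) set \<Rightarrow> bool" where
  "general_position scale U' Fl \<longleftrightarrow>
     (\<forall>C. finite C \<and> (\<forall>Z\<in>C. module.subspace scale Z \<and> Z \<subseteq> U') \<longrightarrow>
        (\<exists>F\<in>Fl. \<forall>Z\<in>C. \<forall>i\<le>vector_space.dim scale U'.
           codim scale (Z \<inter> F i) Z = int (min (vector_space.dim scale Z) i)))"

definition nu :: "('k::field \<Rightarrow> 'b::ab_group_add \<Rightarrow> 'b) \<Rightarrow> ('v \<Rightarrow> 'b) set \<Rightarrow> 'v set \<Rightarrow> int" where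
  "nu scale W I = int (vector_space.dim (fun_scale scale) (theta I ` W))"

definition xi :: "'v set \<Rightarrow> 'v set \<Rightarrow> int" where
  "xi J I = (if J \<subseteq> I then - 1 else 0)"

definition xi_seq :: "'v set list \<Rightarrow> 'v set \<Rightarrow> int" where
  "xi_seq Js I = (\<Sum>J\<leftarrow>Js. xi J I)"

definition UpMin :: "'v set \<Rightarrow> ('v set \<Rightarrow> 'a::linorder) \<Rightarrow> 'v set \<Rightarrow> 'a" where
  "UpMin V \<phi> I = Min (\<phi> ` {K. I \<subseteq> K \<and> K \<subseteq> V})"

end

theory Submission
  imports Defs
begin

text \<open>
  By rank--nullity, cutting \<open>W\<close> with the preimage of a generic subspace of \<open>U\<^sub>I\<close> of
  codimension \<open>e \<le> \<nu>\<^sub>W(I)\<close> changes \<open>\<nu>\<^sub>W(K)\<close> into the minimum of \<open>\<nu>\<^sub>W(K)\<close> and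
  \<open>\<nu>\<^sub>W(K \<union> I) - e\<close>, provided that the subspace is generic with respect to the images under
  \<open>\<theta>\<^sub>I\<close> of \<open>W\<close> and \<open>W \<inter> ker \<theta>\<^sub>K\<close>. Since \<open>\<nu>\<^sub>W\<close> is monotone, this minimum is
  \<open>UpMin (\<nu>\<^sub>W + e \<xi>\<^sub>I)\<close> at \<open>K\<close>. The flags are chosen one after the other, each generic for the finitely
  many intersections that the earlier choices can produce. The results compose because
  \<open>UpMin (UpMin \<phi> + \<psi>) = UpMin (\<phi> + \<psi>)\<close> for antitone \<open>\<psi>\<close>.
\<close>

section \<open>Dimension, coordinates and rank-nullity for finitely generated subspaces\<close>

context vector_space
begin

text \<open>An infinite basis has \<open>card\<close> 0, so \<open>dim\<close> is monotone only
  under a finiteness condition. The finite set \<open>B\<close> makes a basis of \<open>C\<close>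
  finite, and this basis also spans \<open>A\<close>.\<close>

lemma dim_mono_finite_span:
  assumes "A \<subseteq> C" "C \<subseteq> span B" "finite B"
  shows "dim A \<le> dim C"
proof -
  obtain E where E: "E \<subseteq> C" "independent E" "C \<subseteq> span E" "card E = dim C"
    by (rule basis_exists)
  have "finite E"
    using independent_span_bound[of B E] E assms by blast
  then show ?thesis
    using dim_le_card[of A E] E assms by auto
qed

text \<open>Coordinates with respect to \<open>D\<close> are unique. Those of \<open>x\<close> are
  supported both in \<open>C\<close> and in \<open>D - C\<close>, so all of them vanish.\<close>

lemma independent_span_Int_span_Diff:
  assumes D: "independent D" and CD: "C \<subseteq> D"
    and x: "x \<in> span C" "x \<in> span (D - C)"
  shows "x = 0"
proof -
  have 1: "representation D x = representation C x"
    using representation_extend[OF D x(1) CD] by simp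
  have 2: "representation D x = representation (D - C) x"
    using representation_extend[OF D x(2)] by simp
  have none: "{b. representation D x b \<noteq> 0} = {}"
    using representation_ne_zero[of C x] representation_ne_zero[of "D - C" x] 1 2 by auto
  have "x \<in> span D"
    using x(1) CD span_mono by blast
  then have "(\<Sum>b | representation D x b \<noteq> 0. scale (representation D x b) b) = x"
    using sum_nonzero_representation_eq[OF D] by blast
  then show ?thesis
    unfolding none by simp
qed

end

text \<open>A basis \<open>C\<close> of the kernel of \<open>f\<close> on \<open>S\<close> extends
  to a basis \<open>D\<close> of \<open>S\<close>. Then \<open>f\<close> is injective on the span of
  \<open>D - C\<close> and maps \<open>D - C\<close> to a basis of the image. Finiteness is required
  of \<open>S\<close> only, because the ambient function space may have infinite dimension.\<close>

lemma (in vector_space_pair) dim_image_plus_dim_kernel: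
  assumes f: "Vector_Spaces.linear s1 s2 f" and S: "vs1.subspace S" "S \<subseteq> vs1.span B" and B: "finite B"
  shows "vs1.dim S = vs2.dim (f ` S) + vs1.dim (S \<inter> {x. f x = 0})"
proof -
  let ?K = "S \<inter> {x. f x = 0}"
  obtain C where C: "C \<subseteq> ?K" "vs1.independent C" "?K \<subseteq> vs1.span C" "card C = vs1.dim ?K"
    by (rule vs1.basis_exists)
  have "C \<subseteq> S" using C by blast
  then obtain D where D: "C \<subseteq> D" "D \<subseteq> S" "vs1.independent D" "S \<subseteq> vs1.span D"
    using vs1.maximal_independent_subset_extend[OF _ C(2)] by blast
  have finD: "finite D"
    using vs1.independent_span_bound[OF B D(3)] D(2) S(2) by blast
  have inj: "inj_on f (vs1.span (D - C))"
  proof -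
    have "x = 0" if x: "x \<in> vs1.span (D - C)" and 0: "f x = 0" for x
    proof -
      have "vs1.span (D - C) \<subseteq> S"
        using D(2) S(1) by (intro vs1.span_minimal) auto
      then have "x \<in> vs1.span C"
        using C(3) x 0 by auto
      then show "x = 0"
        using vs1.independent_span_Int_span_Diff[OF D(3,1)] x by blast
    qed
    then show ?thesis
      using linear_inj_on_iff_eq_0[OF f vs1.subspace_span] by blast
  qed
  have ind: "vs2.independent (f ` (D - C))"
    using linear_independent_injective_image[OF f _ inj] D(3) vs1.independent_mono by blast
  have "f ` S \<subseteq> vs2.span (f ` (D - C))"
  proof -
    have "f ` D \<subseteq> vs2.span (f ` (D - C))"
    proof (intro image_subsetI)
      fix d assume "d \<in> D"
      then show "f d \<in> vs2.span (f ` (D - C))"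
        using C(1) by (cases "d \<in> C") (auto simp: subset_iff vs2.span_zero intro: vs2.span_base)
    qed
    then have "vs2.span (f ` D) \<subseteq> vs2.span (f ` (D - C))"
      by (rule vs2.span_minimal) simp
    moreover have "f ` S \<subseteq> vs2.span (f ` D)"
      using D(4) linear_span_image[OF f, of D] by auto
    ultimately show ?thesis by blast
  qed
  then have "vs2.dim (f ` S) = card (f ` (D - C))"
    using D(2) ind by (intro vs2.dim_unique[of "f ` (D - C)"]) auto
  also have "\<dots> = card (D - C)"
    using inj vs1.span_superset by (intro card_image) (rule inj_on_subset)
  also have "\<dots> = card D - card C"
    using D(1) finD by (intro card_Diff_subset) (auto intro: finite_subset)
  finally have "vs2.dim (f ` S) = card D - card C" .
  moreover have "vs1.dim S = card D"
    using D by (intro vs1.dim_unique[of D]) auto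
  moreover have "card C \<le> card D"
    using D(1) finD by (rule card_mono[rotated])
  ultimately show ?thesis
    using C(4) by simp
qed

section \<open>Projections and finite generation of the direct sum\<close>

lemma theta_theta: "theta I (theta K x) = theta (I \<inter> K) x"
  by (auto simp: theta_def)

lemma theta_eq_0_iff: "theta I x = 0 \<longleftrightarrow> (\<forall>v\<in>I. x v = 0)"
  by (auto simp: theta_def fun_eq_iff)

lemma theta_direct_sum: "I \<subseteq> V \<Longrightarrow> x \<in> direct_sum Us V \<Longrightarrow> theta I x \<in> direct_sum Us I"
  by (auto simp: theta_def direct_sum_def)

lemma theta_direct_sum_id: "x \<in> direct_sum Us V \<Longrightarrow> theta V x = x"
  by (auto simp: theta_def direct_sum_def fun_eq_iff)

lemma linear_theta:
  assumes "vector_space scale"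
  shows "Vector_Spaces.linear (fun_scale scale) (fun_scale scale) (theta I)"
proof -
  interpret vector_space scale by fact
  interpret f: vector_space "fun_scale scale" by (rule vector_space_fun_scale) fact
  show ?thesis
    by unfold_locales (auto simp: theta_def fun_scale_def fun_eq_iff)
qed

text \<open>Every \<open>x\<close> is the sum of its components \<open>x v\<close> placed at
  coordinate \<open>v\<close> by the inclusion \<open>\<iota> v\<close>, so the images of finite
  spanning sets of the summands generate. This supplies the finite \<open>B\<close> that all
  dimension counts rely on.\<close>

lemma direct_sum_finite_span:
  fixes scale :: "'k::field \<Rightarrow> 'b::ab_group_add \<Rightarrow> 'b" and Us :: "'v \<Rightarrow> 'b set"
  assumes vs: "vector_space scale" and "finite V"
    and Us: "\<And>v. v \<in> V \<Longrightarrow> fin_dim_subspace scale (Us v)"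
  shows "\<exists>B. finite B \<and> direct_sum Us V \<subseteq> module.span (fun_scale scale) B"
proof -
  interpret vector_space scale by fact
  interpret f: vector_space "fun_scale scale :: 'k \<Rightarrow> ('v \<Rightarrow> 'b) \<Rightarrow> _"
    by (rule vector_space_fun_scale) fact
  interpret p: vector_space_pair scale "fun_scale scale :: 'k \<Rightarrow> ('v \<Rightarrow> 'b) \<Rightarrow> _"
    by unfold_locales
  define \<iota> :: "'v \<Rightarrow> 'b \<Rightarrow> 'v \<Rightarrow> 'b" where "\<iota> v b = (\<lambda>w. if w = v then b else 0)" for v b
  have lin: "Vector_Spaces.linear scale (fun_scale scale) (\<iota> v)" for v
    by unfold_locales (auto simp: \<iota>_def fun_scale_def fun_eq_iff)
  obtain B where B: "\<And>v. v \<in> V \<Longrightarrow> finite (B v) \<and> span (B v) = Us v"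
    using Us unfolding fin_dim_subspace_def by metis
  let ?B = "\<Union>v\<in>V. \<iota> v ` B v"
  have "x \<in> f.span ?B" if x: "x \<in> direct_sum Us V" for x
  proof -
    have "\<iota> v (x v) \<in> f.span ?B" if v: "v \<in> V" for v
    proof -
      have "x v \<in> span (B v)"
        using x v B by (auto simp: direct_sum_def)
      then have "\<iota> v (x v) \<in> f.span (\<iota> v ` B v)"
        using p.linear_span_image[OF lin] by blast
      then show ?thesis
        using v f.span_mono[of "\<iota> v ` B v" ?B] by blast
    qed
    then have "(\<Sum>v\<in>V. \<iota> v (x v)) \<in> f.span ?B"
      by (rule f.span_sum)
    moreover have "(\<Sum>v\<in>V. \<iota> v (x v)) = x"
    proof
      fix w
      have "(\<Sum>v\<in>V. \<iota> v (x v)) w = (\<Sum>v\<in>V. \<iota> v (x v) w)"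
        using \<open>finite V\<close> by induction auto
      also have "\<dots> = x w"
        using x \<open>finite V\<close> by (auto simp: \<iota>_def direct_sum_def if_distrib cong: if_cong)
      finally show "(\<Sum>v\<in>V. \<iota> v (x v)) w = x w" .
    qed
    ultimately show ?thesis by simp
  qed
  moreover have "finite ?B" using \<open>finite V\<close> B by auto
  ultimately show ?thesis by blast
qed

section \<open>Rank functions of subspaces and their change under a generic slice\<close>

text \<open>For \<open>I \<subseteq> K\<close> the projection \<open>theta I\<close> factors through
  \<open>theta K\<close>, and a linear map does not raise a finite dimension.\<close>

lemma nu_mono:
  fixes scale :: "'k::field \<Rightarrow> 'b::ab_group_add \<Rightarrow> 'b" and W :: "('v \<Rightarrow> 'b) set"
  assumes vs: "vector_space scale" and B: "finite B" "W \<subseteq> module.span (fun_scale scale) B"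
    and "I \<subseteq> K"
  shows "nu scale W I \<le> nu scale W K"
proof -
  interpret f: vector_space "fun_scale scale :: 'k \<Rightarrow> ('v \<Rightarrow> 'b) \<Rightarrow> _"
    by (rule vector_space_fun_scale) fact
  interpret p: vector_space_pair "fun_scale scale :: 'k \<Rightarrow> ('v \<Rightarrow> 'b) \<Rightarrow> _"
      "fun_scale scale :: 'k \<Rightarrow> ('v \<Rightarrow> 'b) \<Rightarrow> _"
    by unfold_locales
  obtain E where E: "E \<subseteq> theta K ` W" "f.independent E" "theta K ` W \<subseteq> f.span E"
      "card E = f.dim (theta K ` W)"
    by (rule f.basis_exists)
  have "theta K ` W \<subseteq> f.span (theta K ` B)"
    by (rule p.linear_spans_image[OF linear_theta[OF vs] B(2)])
  then have finE: "finite E"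
    using f.independent_span_bound[of "theta K ` B" E] B(1) E by auto
  have "theta I ` W = theta I ` (theta K ` W)"
    using \<open>I \<subseteq> K\<close> by (simp add: image_image theta_theta Int_absorb2)
  also have "\<dots> \<subseteq> f.span (theta I ` E)"
    by (rule p.linear_spans_image[OF linear_theta[OF vs] E(3)])
  finally have "f.dim (theta I ` W) \<le> card (theta I ` E)"
    using finE by (intro f.dim_le_card) auto
  also have "\<dots> \<le> card E" using finE by (rule card_image_le)
  finally show ?thesis using E(4) by (simp add: nu_def)
qed

text \<open>Rank-nullity for \<open>theta K\<close> on the slice writes its rank as a difference of
  two dimensions: that of the slice of \<open>W\<close> and that of the slice of \<open>Z K\<close>,
  the kernel of \<open>theta K\<close> on \<open>W\<close>. General position of \<open>G\<close>
  with respect to the images of \<open>W\<close> and \<open>Z K\<close> under \<open>theta I\<close>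
  determines both.\<close>

lemma nu_vimage:
  fixes scale :: "'k::field \<Rightarrow> 'b::ab_group_add \<Rightarrow> 'b" and W :: "('v \<Rightarrow> 'b) set"
  defines "Z K \<equiv> W \<inter> {x. theta K x = 0}"
  assumes vs: "vector_space scale" and B: "finite B" "W \<subseteq> module.span (fun_scale scale) B"
    and W: "module.subspace (fun_scale scale) W" and G: "module.subspace (fun_scale scale) G"
    and gp: "\<And>L. L \<in> {{}, K} \<Longrightarrow> codim (fun_scale scale) (theta I ` Z L \<inter> G) (theta I ` Z L)
      = int (min (vector_space.dim (fun_scale scale) (theta I ` Z L)) e)"
    and e: "int e \<le> nu scale W I"
  shows "nu scale (W \<inter> {x. theta I x \<in> G}) K = min (nu scale W K) (nu scale W (K \<union> I) - int e)"
proof -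
  interpret f: vector_space "fun_scale scale :: 'k \<Rightarrow> ('v \<Rightarrow> 'b) \<Rightarrow> _"
    by (rule vector_space_fun_scale) fact
  interpret p: vector_space_pair "fun_scale scale :: 'k \<Rightarrow> ('v \<Rightarrow> 'b) \<Rightarrow> _"
      "fun_scale scale :: 'k \<Rightarrow> ('v \<Rightarrow> 'b) \<Rightarrow> _"
    by unfold_locales
  note lin = linear_theta[OF vs]
  have kersub: "f.subspace (S \<inter> {x. theta L x = 0})" if "f.subspace S" for S L
    using that p.linear_subspace_kernel[OF lin] by (rule f.subspace_inter)
  have rank: "int (f.dim S) = nu scale S L + int (f.dim (S \<inter> {x. theta L x = 0}))"
    if "f.subspace S" "S \<subseteq> W" for S L
    using p.dim_image_plus_dim_kernel[OF lin that(1) _ B(1), of L] that(2) B(2)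
    by (simp add: nu_def)
  let ?T = "{x. theta I x \<in> G}"
  have T: "f.subspace ?T"
    using G by (rule p.linear_subspace_linear_preimage[OF lin])
  \<comment> \<open>On \<open>Z L\<close> and on its slice \<open>theta I\<close> has the same
    kernel, since \<open>G\<close> contains 0. The drop in dimension is therefore that of the image,
    which general position gives.\<close>
  have cut: "int (f.dim (Z L \<inter> ?T)) = int (f.dim (Z L)) - min (nu scale (Z L) I) (int e)"
    if L: "L \<in> {{}, K}" for L
  proof -
    have Z: "f.subspace (Z L)" "Z L \<subseteq> W"
      unfolding Z_def using kersub[OF W] by auto
    have im: "theta I ` (Z L \<inter> ?T) = theta I ` Z L \<inter> G" by auto
    have ker: "Z L \<inter> ?T \<inter> {x. theta I x = 0} = Z L \<inter> {x. theta I x = 0}"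
      using f.subspace_0[OF G] by auto
    have "int (f.dim (Z L \<inter> ?T)) = int (f.dim (theta I ` Z L \<inter> G))
        + int (f.dim (Z L \<inter> {x. theta I x = 0}))"
      using rank[of "Z L \<inter> ?T" I] f.subspace_inter[OF Z(1) T] Z(2)
      unfolding nu_def im ker by auto
    then show ?thesis
      using rank[OF Z, of I] gp[OF L] unfolding codim_def nu_def by simp
  qed
  \<comment> \<open>The case \<open>L = {}\<close> is \<open>W\<close> itself, where the bound on
    \<open>e\<close> turns the minimum in \<open>cut\<close> into \<open>e\<close>.\<close>
  have Z0: "Z {} = W" by (simp add: Z_def theta_eq_0_iff)
  have W': "int (f.dim (W \<inter> ?T)) = int (f.dim W) - int e"
    using cut[of "{}"] e by (simp add: Z0)
  have "nu scale (W \<inter> ?T) K = int (f.dim (W \<inter> ?T)) - int (f.dim (Z K \<inter> ?T))"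
    using rank[OF f.subspace_inter[OF W T], of K] by (simp add: Z_def Int_ac)
  moreover have "int (f.dim (Z K)) = int (f.dim W) - nu scale W K"
    using rank[OF W, of K] by (simp add: Z_def)
  \<comment> \<open>The kernel of \<open>theta I\<close> on \<open>Z K\<close> is
    \<open>Z (K \<union> I)\<close>, so its dimension can be eliminated between two instances of
    rank-nullity.\<close>
  moreover have "nu scale (Z K) I = nu scale W (K \<union> I) - nu scale W K"
  proof -
    have "Z K \<inter> {x. theta I x = 0} = Z (K \<union> I)"
      by (auto simp: Z_def theta_eq_0_iff)
    then show ?thesis
      using rank[OF kersub[OF W], of K I] rank[OF W, of K] rank[OF W, of "K \<union> I"]
      by (simp add: Z_def)
  qed
  ultimately show ?thesis
    using cut[of K] W' by simp
qed

section \<open>Minima over supersets\<close>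

lemma UpMin_eqI:
  fixes \<phi> :: "'v set \<Rightarrow> 'a::linorder"
  assumes "finite V" "K \<subseteq> V"
    and "\<And>L. K \<subseteq> L \<Longrightarrow> L \<subseteq> V \<Longrightarrow> a \<le> \<phi> L"
    and "K \<subseteq> L" "L \<subseteq> V" "\<phi> L = a"
  shows "UpMin V \<phi> K = a"
  unfolding UpMin_def
  by (rule Min_eqI) (use assms in auto)

lemma UpMin_le:
  fixes \<phi> :: "'v set \<Rightarrow> 'a::linorder"
  assumes "finite V" "K \<subseteq> L" "L \<subseteq> V"
  shows "UpMin V \<phi> K \<le> \<phi> L"
  unfolding UpMin_def by (rule Min_le) (use assms in auto)

lemma UpMin_attained:
  fixes \<phi> :: "'v set \<Rightarrow> 'a::linorder"
  assumes "finite V" "K \<subseteq> V"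
  obtains L where "K \<subseteq> L" "L \<subseteq> V" "UpMin V \<phi> K = \<phi> L"
proof -
  have "UpMin V \<phi> K \<in> \<phi> ` {L. K \<subseteq> L \<and> L \<subseteq> V}"
    unfolding UpMin_def by (rule Min_in) (use assms in auto)
  then show thesis using that by auto
qed

text \<open>One inequality is \<open>UpMin V \<phi> \<le> \<phi>\<close>. For the other, the inner
  minimum at \<open>L\<close> is attained at some \<open>M\<close> containing \<open>L\<close>, and
  passing from \<open>L\<close> to \<open>M\<close> can only lower \<open>\<psi>\<close>. This is
  what merges successive slices into one correction.\<close>

lemma UpMin_UpMin_add:
  fixes \<phi> \<psi> :: "'v set \<Rightarrow> 'a::linordered_ab_group_add"
  assumes V: "finite V" and K: "K \<subseteq> V"
    and anti: "\<And>L M. L \<subseteq> M \<Longrightarrow> \<psi> M \<le> \<psi> L"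
  shows "UpMin V (\<lambda>L. UpMin V \<phi> L + \<psi> L) K = UpMin V (\<lambda>L. \<phi> L + \<psi> L) K"
proof (rule antisym)
  obtain L where L: "K \<subseteq> L" "L \<subseteq> V" "UpMin V (\<lambda>L. \<phi> L + \<psi> L) K = \<phi> L + \<psi> L"
    using UpMin_attained[OF V K, of "\<lambda>L. \<phi> L + \<psi> L"] by blast
  have "UpMin V (\<lambda>L. UpMin V \<phi> L + \<psi> L) K \<le> UpMin V \<phi> L + \<psi> L"
    using V L by (intro UpMin_le)
  also have "\<dots> \<le> \<phi> L + \<psi> L"
    using V L UpMin_le[of V L L \<phi>] by simp
  finally show "UpMin V (\<lambda>L. UpMin V \<phi> L + \<psi> L) K \<le> UpMin V (\<lambda>L. \<phi> L + \<psi> L) K"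
    using L by simp
next
  obtain L where L: "K \<subseteq> L" "L \<subseteq> V" "UpMin V (\<lambda>L. UpMin V \<phi> L + \<psi> L) K = UpMin V \<phi> L + \<psi> L"
    using UpMin_attained[OF V K, of "\<lambda>L. UpMin V \<phi> L + \<psi> L"] by blast
  obtain M where M: "L \<subseteq> M" "M \<subseteq> V" "UpMin V \<phi> L = \<phi> M"
    using UpMin_attained[OF V L(2), of \<phi>] by blast
  have "UpMin V (\<lambda>L. \<phi> L + \<psi> L) K \<le> \<phi> M + \<psi> M"
    using V L M by (intro UpMin_le) auto
  also have "\<dots> \<le> \<phi> M + \<psi> L"
    using anti[OF M(1)] by simp
  finally show "UpMin V (\<lambda>L. \<phi> L + \<psi> L) K \<le> UpMin V (\<lambda>L. UpMin V \<phi> L + \<psi> L) K"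
    using L M by simp
qed

section \<open>The functions \<open>xi\<close> and their multiplicities\<close>

lemma xi_antimono: "L \<subseteq> M \<Longrightarrow> xi J M \<le> xi J L"
  by (auto simp: xi_def)

lemma xi_le_0: "xi J K \<le> 0"
  by (simp add: xi_def)

text \<open>The correction is \<open>-e\<close> on the supersets of \<open>I\<close> and 0
  elsewhere. As \<open>\<phi>\<close> is monotone, the only candidates for the minimum are
  \<open>K\<close> and the least superset \<open>K \<union> I\<close> of both sets. The right-hand
  side is the form in which \<open>nu_vimage\<close> gives the rank of a slice.\<close>

lemma UpMin_add_multiple_xi:
  assumes V: "finite V" "K \<subseteq> V" "I \<subseteq> V"
    and mono: "\<And>L M. L \<subseteq> M \<Longrightarrow> M \<subseteq> V \<Longrightarrow> \<phi> L \<le> \<phi> M"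
  shows "UpMin V (\<lambda>L. \<phi> L + int e * xi I L) K = min (\<phi> K) (\<phi> (K \<union> I) - int e)"
proof (cases "\<phi> K < \<phi> (K \<union> I) - int e")
  case True
  \<comment> \<open>If \<open>I\<close> were contained in \<open>K\<close>, the strict inequality
    would read \<open>\<phi> K < \<phi> K - int e\<close>. Hence the correction vanishes at the
    witness \<open>K\<close>.\<close>
  then have "\<not> I \<subseteq> K" by (auto simp: Un_absorb2)
  with True show ?thesis
  proof (intro UpMin_eqI[where L = K] V)
    fix L assume L: "K \<subseteq> L" "L \<subseteq> V"
    then have "\<phi> K \<le> \<phi> L" by (rule mono)
    moreover have "\<phi> (K \<union> I) \<le> \<phi> L" if "I \<subseteq> L" using L that by (intro mono) auto
    ultimately show "min (\<phi> K) (\<phi> (K \<union> I) - int e) \<le> \<phi> L + int e * xi I L"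
      using True by (auto simp: xi_def)
  qed (auto simp: xi_def V)
next
  case False
  then show ?thesis
  proof (intro UpMin_eqI[where L = "K \<union> I"] V)
    fix L assume L: "K \<subseteq> L" "L \<subseteq> V"
    then have "\<phi> K \<le> \<phi> L" by (rule mono)
    moreover have "\<phi> (K \<union> I) \<le> \<phi> L" if "I \<subseteq> L" using L that by (intro mono) auto
    ultimately show "min (\<phi> K) (\<phi> (K \<union> I) - int e) \<le> \<phi> L + int e * xi I L"
      using False by (auto simp: xi_def)
  qed (use V in \<open>auto simp: xi_def\<close>)
qed

text \<open>Equal members of the sequence are collected; \<open>count_list Js I\<close> is the
  multiplicity of \<open>I\<close>. This allows the sequence to be replaced by exponents attached to
  flags.\<close>

lemma xi_seq_eq_sum:
  assumes "finite A" "set Js \<subseteq> A"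
  shows "xi_seq Js K = (\<Sum>I\<in>A. int (count_list Js I) * xi I K)"
  using assms(2)
proof (induction Js)
  case (Cons J Js)
  have "(\<Sum>I\<in>A. int (count_list (J # Js) I) * xi I K)
      = (\<Sum>I\<in>A. (if I = J then xi I K else 0) + int (count_list Js I) * xi I K)"
    by (intro sum.cong) (auto simp: algebra_simps)
  also have "\<dots> = xi J K + (\<Sum>I\<in>A. int (count_list Js I) * xi I K)"
    using assms(1) Cons.prems by (simp add: sum.distrib)
  finally show ?case
    using Cons by (simp add: xi_seq_def)
qed (simp add: xi_seq_def)

section \<open>Inductive choice of the flags\<close>

text \<open>Flags are indexed by an abstract finite set \<open>P\<close>, so that several flags may
  belong to the same subset \<open>J p\<close> and can be added one at a time. The flags are fixed
  before \<open>W\<close> and \<open>e\<close>, so each must be generic for all slices that can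
  arise.\<close>

lemma exists_flags:
  fixes scale :: "'k::field \<Rightarrow> 'b::ab_group_add \<Rightarrow> 'b"
    and V :: "'v set" and Us :: "'v \<Rightarrow> 'b set" and J :: "'p \<Rightarrow> 'v set"
    and Fl :: "'v set \<Rightarrow> (nat \<Rightarrow> ('v \<Rightarrow> 'b) set) set"
  assumes vs: "vector_space scale" and V: "finite V"
    and Us: "\<And>v. v \<in> V \<Longrightarrow> fin_dim_subspace scale (Us v)"
    and flag: "\<And>I F. I \<subseteq> V \<Longrightarrow> F \<in> Fl I \<Longrightarrow> complete_flag (fun_scale scale) (direct_sum Us I) F"
    and gp: "\<And>I. I \<subseteq> V \<Longrightarrow> general_position (fun_scale scale) (direct_sum Us I) (Fl I)"
    and P: "finite P" "\<And>p. p \<in> P \<Longrightarrow> J p \<subseteq> V"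
    and \<W>: "finite \<W>"
      "\<And>W. W \<in> \<W> \<Longrightarrow> module.subspace (fun_scale scale) W \<and> W \<subseteq> direct_sum Us V"
  shows "\<exists>F. (\<forall>p\<in>P. F p \<in> Fl (J p)) \<and>
    (\<forall>W\<in>\<W>. \<forall>e :: 'p \<Rightarrow> nat.
      (\<forall>K\<subseteq>V. nu scale W K + (\<Sum>p\<in>P. int (e p) * xi (J p) K) \<ge> 0) \<longrightarrow>
      (\<forall>K\<subseteq>V. nu scale (W \<inter> (\<Inter>p\<in>P. {x \<in> direct_sum Us V. theta (J p) x \<in> F p (e p)})) K
        = UpMin V (\<lambda>L. nu scale W L + (\<Sum>p\<in>P. int (e p) * xi (J p) L)) K))"
proof -
  interpret f: vector_space "fun_scale scale :: 'k \<Rightarrow> ('v \<Rightarrow> 'b) \<Rightarrow> _"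
    by (rule vector_space_fun_scale) fact
  interpret p: vector_space_pair "fun_scale scale :: 'k \<Rightarrow> ('v \<Rightarrow> 'b) \<Rightarrow> _"
      "fun_scale scale :: 'k \<Rightarrow> ('v \<Rightarrow> 'b) \<Rightarrow> _"
    by unfold_locales
  let ?U = "direct_sum Us V"
  note lin = linear_theta[OF vs]
  obtain B where B: "finite B" "?U \<subseteq> f.span B"
    using direct_sum_finite_span[OF vs V, of Us] Us by blast
  have mono: "nu scale W L \<le> nu scale W M" if "W \<subseteq> ?U" "L \<subseteq> M" for W L M
    using nu_mono[OF vs B(1) _ that(2)] that(1) B(2) by blast
  show ?thesis
    using P \<W>
  \<comment> \<open>The family \<open>\<W>\<close> varies: the flag for the new index is chosen for
    \<open>\<W>\<close>, and the remaining flags come from the induction hypothesis for the larger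
    family of its slices.\<close>
  proof (induction P arbitrary: \<W> rule: finite_induct)
    case empty
    have "nu scale W K = UpMin V (nu scale W) K" if "W \<in> \<W>" "K \<subseteq> V" for W K
      using that empty.prems mono V by (intro UpMin_eqI[symmetric, where L = K]) auto
    then show ?case by auto
  next
    case (insert q P)
    let ?I = "J q"
    let ?n = "f.dim (direct_sum Us ?I)"
    let ?D = "(\<lambda>(W, K). theta ?I ` (W \<inter> {x. theta K x = 0})) ` (\<W> \<times> Pow V)"
    have I: "?I \<subseteq> V" using insert.prems by simp
    \<comment> \<open>The members of \<open>?D\<close> are the images whose general position
      \<open>nu_vimage\<close> asks for, taken over all \<open>K\<close> at once;
      \<open>K = {}\<close> contributes the image of \<open>W\<close>.\<close>
    have "finite ?D" using insert.prems V by auto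
    moreover have "\<forall>Z\<in>?D. f.subspace Z \<and> Z \<subseteq> direct_sum Us ?I"
      using insert.prems(3) theta_direct_sum[OF I]
      by (auto intro!: p.linear_subspace_image[OF lin] f.subspace_inter
          p.linear_subspace_kernel[OF lin])
    ultimately obtain G where G: "G \<in> Fl ?I"
      and gen: "\<And>Z i. Z \<in> ?D \<Longrightarrow> i \<le> ?n \<Longrightarrow>
        codim (fun_scale scale) (Z \<inter> G i) Z = int (min (f.dim Z) i)"
      using gp[OF I] unfolding general_position_def by metis
    have subG: "f.subspace (G i)" if "i \<le> ?n" for i
      using flag[OF I G] that by (simp add: complete_flag_def)
    define pre where "pre i = {x \<in> ?U. theta ?I x \<in> G i}" for i
    have pre: "W \<inter> pre i = W \<inter> {x. theta ?I x \<in> G i}" if "W \<in> \<W>" for W i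
      using insert.prems(3)[OF that] by (auto simp: pre_def)
    \<comment> \<open>Exponents are cut off at \<open>?n\<close>, which keeps the family finite and
      stays in the range where the flag consists of subspaces. The bound \<open>en\<close> below
      shows that no admissible exponent is lost.\<close>
    let ?\<W> = "(\<lambda>(W, i). W \<inter> pre i) ` (\<W> \<times> {..?n})"
    have fin: "finite ?\<W>" using insert.prems by auto
    have sub: "f.subspace W \<and> W \<subseteq> ?U" if WW: "W \<in> ?\<W>" for W
    proof -
      obtain X i where X: "X \<in> \<W>" "i \<le> ?n" "W = X \<inter> pre i"
        using WW by auto
      show ?thesis
        using X(1) insert.prems(3) unfolding X(3) pre[OF X(1)]
        by (auto intro!: f.subspace_inter p.linear_subspace_linear_preimage[OF lin subG[OF X(2)]])
    qed
    have JP: "J p \<subseteq> V" if "p \<in> P" for p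
      using that insert.prems(1) by blast
    obtain F where F: "\<forall>p\<in>P. F p \<in> Fl (J p)"
      and nuF: "\<forall>W\<in>?\<W>. \<forall>e :: 'p \<Rightarrow> nat.
        (\<forall>K\<subseteq>V. nu scale W K + (\<Sum>p\<in>P. int (e p) * xi (J p) K) \<ge> 0) \<longrightarrow>
        (\<forall>K\<subseteq>V. nu scale (W \<inter> (\<Inter>p\<in>P. {x \<in> ?U. theta (J p) x \<in> F p (e p)})) K
          = UpMin V (\<lambda>L. nu scale W L + (\<Sum>p\<in>P. int (e p) * xi (J p) L)) K)"
      using insert.IH[OF JP fin sub] by blast
    let ?F = "F(q := G)"
    have "nu scale (W \<inter> (\<Inter>p\<in>insert q P. {x \<in> ?U. theta (J p) x \<in> ?F p (e p)})) K
        = UpMin V (\<lambda>L. nu scale W L + (\<Sum>p\<in>insert q P. int (e p) * xi (J p) L)) K"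
      if W: "W \<in> \<W>" and K: "K \<subseteq> V"
        and nonneg: "\<forall>K\<subseteq>V. nu scale W K + (\<Sum>p\<in>insert q P. int (e p) * xi (J p) K) \<ge> 0"
      for W K and e :: "'p \<Rightarrow> nat"
    proof -
      let ?\<psi> = "\<lambda>L. \<Sum>p\<in>P. int (e p) * xi (J p) L"
      let ?\<phi> = "\<lambda>L. nu scale W L + int (e q) * xi ?I L"
      have WU: "W \<subseteq> ?U" "f.subspace W" using insert.prems(3)[OF W] by auto
      have total: "(\<Sum>p\<in>insert q P. int (e p) * xi (J p) L) = int (e q) * xi ?I L + ?\<psi> L" for L
        using insert.hyps by simp
      \<comment> \<open>Evaluating nonnegativity at \<open>?I\<close>, where the new flag
        contributes \<open>- e q\<close> and the others at most 0, bounds \<open>e q\<close> by the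
        rank of \<open>W\<close> at \<open>?I\<close>, hence by \<open>?n\<close>.\<close>
      have "?\<psi> ?I \<le> 0"
        by (intro sum_nonpos mult_nonneg_nonpos xi_le_0) simp
      moreover have "nu scale W ?I + (int (e q) * xi ?I ?I + ?\<psi> ?I) \<ge> 0"
        using nonneg I unfolding total by blast
      ultimately have eq: "int (e q) \<le> nu scale W ?I"
        by (simp add: xi_def)
      also have "nu scale W ?I \<le> int ?n"
      proof -
        obtain C where "finite C" "direct_sum Us ?I \<subseteq> f.span C"
          using direct_sum_finite_span[OF vs finite_subset[OF I V], of Us] Us I by blast
        moreover have "theta ?I ` W \<subseteq> direct_sum Us ?I"
          using WU theta_direct_sum[OF I] by blast
        ultimately show ?thesis
          by (simp add: nu_def f.dim_mono_finite_span[of _ _ C])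
      qed
      finally have en: "e q \<le> ?n" by simp
      let ?W = "W \<inter> pre (e q)"
      have step: "nu scale ?W L = UpMin V ?\<phi> L" if L: "L \<subseteq> V" for L
      proof -
        have "nu scale ?W L = min (nu scale W L) (nu scale W (L \<union> ?I) - int (e q))"
          unfolding pre[OF W]
          using W L en gen WU B eq subG by (intro nu_vimage[OF vs B(1)]) auto
        also have "\<dots> = UpMin V ?\<phi> L"
          using mono WU by (intro UpMin_add_multiple_xi[OF V L I, symmetric])
        finally show ?thesis .
      qed
      have anti: "?\<psi> M \<le> ?\<psi> L" if "L \<subseteq> M" for L M
        using that by (intro sum_mono mult_left_mono xi_antimono) auto
      \<comment> \<open>Since \<open>?\<psi>\<close> is antitone, the minimum produced by the first
        slice is absorbed into the outer one.\<close>
      have collapse: "UpMin V (\<lambda>L. UpMin V ?\<phi> L + ?\<psi> L) L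
          = UpMin V (\<lambda>L. nu scale W L + (\<Sum>p\<in>insert q P. int (e p) * xi (J p) L)) L"
        if "L \<subseteq> V" for L
        unfolding total using UpMin_UpMin_add[where \<phi> = ?\<phi> and \<psi> = ?\<psi>, OF V that anti] by (simp add: add.assoc)
      have step_add: "UpMin V (\<lambda>L. nu scale ?W L + ?\<psi> L) L = UpMin V (\<lambda>L. UpMin V ?\<phi> L + ?\<psi> L) L"
        for L
        unfolding UpMin_def[of V _ L]
        by (intro arg_cong[where f = Min] image_cong) (auto simp: step)
      \<comment> \<open>The slice inherits the hypothesis: the new sum at \<open>L\<close> is at
        least its minimum over supersets, and by \<open>collapse\<close> that minimum is a value of
        the original nonnegative sum.\<close>
      have nonneg': "\<forall>L\<subseteq>V. nu scale ?W L + ?\<psi> L \<ge> 0"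
      proof (intro allI impI)
        fix L assume L: "L \<subseteq> V"
        obtain M where "M \<subseteq> V"
          "UpMin V (\<lambda>L. nu scale W L + (\<Sum>p\<in>insert q P. int (e p) * xi (J p) L)) L
            = nu scale W M + (\<Sum>p\<in>insert q P. int (e p) * xi (J p) M)"
          by (rule UpMin_attained[OF V L,
            of "\<lambda>L. nu scale W L + (\<Sum>p\<in>insert q P. int (e p) * xi (J p) L)"]) blast
        then have "0 \<le> UpMin V (\<lambda>L. UpMin V ?\<phi> L + ?\<psi> L) L"
          unfolding collapse[OF L] using nonneg by simp
        also have "\<dots> \<le> UpMin V ?\<phi> L + ?\<psi> L"
          using V L by (intro UpMin_le) auto
        finally show "nu scale ?W L + ?\<psi> L \<ge> 0"
          using step[OF L] by simp
      qed
      have "W \<inter> (\<Inter>p\<in>insert q P. {x \<in> ?U. theta (J p) x \<in> ?F p (e p)})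
          = ?W \<inter> (\<Inter>p\<in>P. {x \<in> ?U. theta (J p) x \<in> F p (e p)})"
        using insert.hyps(2) by (auto simp: pre_def split: if_splits)
      moreover have "?W \<in> ?\<W>" using W en by auto
      from nuF[THEN bspec, OF this, THEN spec[of _ e], THEN mp, OF nonneg', THEN spec, THEN mp, OF K]
      have "nu scale (?W \<inter> (\<Inter>p\<in>P. {x \<in> ?U. theta (J p) x \<in> F p (e p)})) K
          = UpMin V (\<lambda>L. nu scale ?W L + ?\<psi> L) K"
        .
      ultimately show ?thesis
        using step_add[of K] collapse[OF K] by simp
    qed
    note nu = this
    have "?F p \<in> Fl (J p)" if "p \<in> insert q P" for p
      using that F G by auto
    with nu show ?case
      by (intro exI[of _ ?F] conjI ballI allI impI)
  qed
qed

section \<open>Passage from sequences of subsets to flag exponents, and the codimension\<close>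

theorem theorem6p2:
  fixes scale :: "'k::field \<Rightarrow> 'b::ab_group_add \<Rightarrow> 'b"
    and V :: "'v set"
    and Us :: "'v \<Rightarrow> 'b set"
    and \<W> :: "('v \<Rightarrow> 'b) set set"
    and m :: "'v set \<Rightarrow> nat"
    and Fl :: "'v set \<Rightarrow> (nat \<Rightarrow> ('v \<Rightarrow> 'b) set) set"
  assumes "vector_space scale"
    and "finite V"
    and "\<And>v. v \<in> V \<Longrightarrow> fin_dim_subspace scale (Us v)"
    and "finite \<W>"
    and "\<And>W. W \<in> \<W> \<Longrightarrow> module.subspace (fun_scale scale) W \<and> W \<subseteq> direct_sum Us V"
    and "\<And>I F. I \<subseteq> V \<Longrightarrow> F \<in> Fl I \<Longrightarrow> complete_flag (fun_scale scale) (direct_sum Us I) F"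
    and "\<And>I. I \<subseteq> V \<Longrightarrow> general_position (fun_scale scale) (direct_sum Us I) (Fl I)"
  shows "\<exists>F :: 'v set \<Rightarrow> nat \<Rightarrow> nat \<Rightarrow> ('v \<Rightarrow> 'b) set.
    (\<forall>I\<subseteq>V. \<forall>r\<in>{1..m I}. F I r \<in> Fl I) \<and>
    (\<forall>W\<in>\<W>. \<forall>Js :: 'v set list. \<forall>e :: 'v set \<Rightarrow> nat \<Rightarrow> nat.
       set Js \<subseteq> Pow V \<longrightarrow>
       (\<forall>I\<subseteq>V. nu scale W I + xi_seq Js I \<ge> 0) \<longrightarrow>
       (\<forall>I\<subseteq>V. (\<Sum>r=1..m I. e I r) = count_list Js I) \<longrightarrow>
       (let W' = W \<inter> (\<Inter>I\<in>Pow V. \<Inter>r\<in>{1..m I}.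
                    {x \<in> direct_sum Us V. theta I x \<in> F I r (e I r)})
        in (\<forall>I\<subseteq>V. UpMin V (\<lambda>K. nu scale W K + xi_seq Js K) I = nu scale W' I) \<and>
           codim (fun_scale scale) W' W = \<bar>xi_seq Js V\<bar> \<and>
           \<bar>xi_seq Js V\<bar> = int (length Js)))"
proof -
  let ?U = "direct_sum Us V"
  \<comment> \<open>A pair \<open>(I, r)\<close> stands for the \<open>r\<close>-th flag of
    \<open>I\<close>, and \<open>fst\<close> recovers the subset.\<close>
  let ?P = "SIGMA I:Pow V. {1..m I}"
  let ?S = "\<lambda>F e I r. {x \<in> ?U. theta I x \<in> F (I, r) (e I r :: nat)}"
  have P: "finite ?P" using assms(2) by auto
  obtain F where F: "\<And>I r. (I, r) \<in> ?P \<Longrightarrow> F (I, r) \<in> Fl I"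
    and nuF: "\<And>W e K. W \<in> \<W> \<Longrightarrow>
      (\<forall>K\<subseteq>V. nu scale W K + (\<Sum>p\<in>?P. int (e p) * xi (fst p) K) \<ge> 0) \<Longrightarrow> K \<subseteq> V \<Longrightarrow>
      nu scale (W \<inter> (\<Inter>p\<in>?P. {x \<in> ?U. theta (fst p) x \<in> F p (e p)})) K
        = UpMin V (\<lambda>L. nu scale W L + (\<Sum>p\<in>?P. int (e p) * xi (fst p) L)) K"
  proof -
    have "fst p \<subseteq> V" if "p \<in> ?P" for p
      using that by auto
    from exists_flags[where Us = Us and Fl = Fl and J = fst, OF assms(1-3,6,7) P this assms(4,5)]
    obtain F where "\<forall>p\<in>?P. F p \<in> Fl (fst p)"
      and "\<forall>W\<in>\<W>. \<forall>e. (\<forall>K\<subseteq>V. nu scale W K + (\<Sum>p\<in>?P. int (e p) * xi (fst p) K) \<ge> 0) \<longrightarrow>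
        (\<forall>K\<subseteq>V. nu scale (W \<inter> (\<Inter>p\<in>?P. {x \<in> ?U. theta (fst p) x \<in> F p (e p)})) K
          = UpMin V (\<lambda>L. nu scale W L + (\<Sum>p\<in>?P. int (e p) * xi (fst p) L)) K)"
      by blast
    then show ?thesis
      by (intro that[of F]) (force, blast)
  qed
  have main: "(\<forall>I\<subseteq>V. UpMin V (\<lambda>K. nu scale W K + xi_seq Js K) I = nu scale W' I) \<and>
      codim (fun_scale scale) W' W = \<bar>xi_seq Js V\<bar> \<and> \<bar>xi_seq Js V\<bar> = int (length Js)"
    if W: "W \<in> \<W>" and Js: "set Js \<subseteq> Pow V"
      and nonneg: "\<forall>I\<subseteq>V. nu scale W I + xi_seq Js I \<ge> 0"
      and e: "\<forall>I\<subseteq>V. (\<Sum>r=1..m I. e I r) = count_list Js I"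
      and W': "W' = W \<inter> (\<Inter>I\<in>Pow V. \<Inter>r\<in>{1..m I}. ?S F e I r)"
    for W W' Js and e :: "'v set \<Rightarrow> nat \<Rightarrow> nat"
  proof -
    \<comment> \<open>The parts \<open>e I r\<close> add up to the multiplicity of \<open>I\<close>,
      so the total correction depends on the sequence alone and not on the chosen
      partitions.\<close>
    have xi: "xi_seq Js K = (\<Sum>p\<in>?P. int (case_prod e p) * xi (fst p) K)" for K
    proof -
      have "xi_seq Js K = (\<Sum>I\<in>Pow V. \<Sum>r=1..m I. int (e I r) * xi I K)"
        using xi_seq_eq_sum[OF _ Js, of K] assms(2) e
        by (simp flip: sum_distrib_right of_nat_sum)
      also have "\<dots> = (\<Sum>p\<in>?P. int (case_prod e p) * xi (fst p) K)"
        using assms(2) by (subst sum.Sigma) (auto intro!: sum.cong)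
      finally show ?thesis .
    qed
    have W'_P: "W' = W \<inter> (\<Inter>p\<in>?P. {x \<in> ?U. theta (fst p) x \<in> F p (case_prod e p)})"
      unfolding W' by auto
    have nuW': "UpMin V (\<lambda>K. nu scale W K + xi_seq Js K) I = nu scale W' I" if "I \<subseteq> V" for I
      using nuF[OF W _ that, of "case_prod e"] nonneg unfolding xi W'_P by simp
    have len: "xi_seq Js V = - int (length Js)"
      using Js by (induction Js) (auto simp: xi_seq_def xi_def)
    have sub: "W \<subseteq> ?U" using assms(5)[OF W] by simp
    then have sub': "W' \<subseteq> ?U" unfolding W' by blast
    \<comment> \<open>On the full direct sum \<open>theta V\<close> is the identity, so ranks at
      \<open>V\<close> are dimensions.\<close>
    have dim: "nu scale X V = int (vector_space.dim (fun_scale scale) X)" if "X \<subseteq> ?U" for X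
    proof -
      have "theta V ` X = X"
        using theta_direct_sum_id that by (force simp: image_def)
      then show ?thesis by (simp add: nu_def)
    qed
    \<comment> \<open>The only superset of \<open>V\<close> inside \<open>V\<close> is
      \<open>V\<close> itself, so the rank identity at \<open>V\<close> compares the dimensions of
      \<open>W'\<close> and \<open>W\<close>.\<close>
    have "UpMin V (\<lambda>K. nu scale W K + xi_seq Js K) V = nu scale W V + xi_seq Js V"
      using assms(2) by (intro UpMin_eqI[where L = V]) (auto dest: antisym)
    then have "codim (fun_scale scale) W' W = int (length Js)"
      using nuW'[of V] dim[OF sub] dim[OF sub'] len by (simp add: codim_def)
    then show ?thesis
      using nuW' len by simp
  qed
  show ?thesis
    unfolding Let_def
  proof (intro exI[of _ "\<lambda>I r. F (I, r)"] conjI)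
    show "\<forall>I\<subseteq>V. \<forall>r\<in>{1..m I}. F (I, r) \<in> Fl I"
      using F by auto
  qed (intro ballI allI impI, rule main[OF _ _ _ _ refl]; assumption)
qed

end
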